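(* Let $(\mathcal{C},\otimes,F,G,a,\Phi,d)$ be a hom-braided category. Let $\Theta:\mathrm{id}_{\mathcal{C}}\to F$ be a natural isomorphism such that $\Theta_{M\otimes N}=\Theta_M\otimes\Theta_N$ for all objects $M,N\in\mathcal{C}$, and for all objects $U,V,W$ let $b_{U,V,W}:(U\otimes V)\otimes W\to U\otimes(V\otimes W)$ be $$b_{U,V,W}=(\Theta_U^{-1}\otimes\mathrm{id}_{V\otimes W})\circ a_{U,V,W}\circ(\mathrm{id}_{U\otimes V}\otimes\Theta_W).$$ Suppose that $\Phi$ is a natural isomorphism and that $G(\Theta_U)=\Theta_{G(U)}$ for all objects $U$. Define $c_{U,V}:U\otimes V\to V\otimes U$ by $$c_{U,V}=(\Phi_V^{-1}\otimes\Phi_U^{-1})\circ d_{U,V}$$ for all objects $U,V\in\mathcal{C}$. Then $c$ is a quasi-braiding, so that $(\mathcal{C},\otimes,b,c)$ is a quasi-braided pre-tensor category.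
   Context: A hom-tensor category is a 6-tuple $(\mathcal{C},\otimes,F,G,a,\Phi)$ where: $\mathcal{C}$ is a category; $\otimes:\mathcal{C}\times\mathcal{C}\to\mathcal{C}$ is a functor; $F,G:\mathcal{C}\to\mathcal{C}$ are functors with $F(U\otimes V)=F(U)\otimes F(V)$, $F(f\otimes g)=F(f)\otimes F(g)$, and likewise $G(U\otimes V)=G(U)\otimes G(V)$, $G(f\otimes g)=G(f)\otimes G(g)$, for all objects $U,V$ and morphisms $f,g$; $FG=GF$; $a_{X,Y,Z}:(X\otimes Y)\otimes F(Z)\to F(X)\otimes(Y\otimes Z)$ is a natural isomorphism satisfying, for all objects $X,Y,Z,T$, $$a_{F(X),F(Y),Z\otimes T}\circ a_{X\otimes Y,F(Z),F(T)}=(\mathrm{id}_{F^2(X)}\otimes a_{Y,Z,T})\circ a_{F(X),Y\otimes Z,F(T)}\circ(a_{X,Y,Z}\otimes \mathrm{id}_{F^2(T)});$$ $\Phi:\mathrm{id}_{\mathcal{C}}\to G$ is a natural transformation with $F(\Phi_U)=\Phi_{F(U)}$, $G(\Phi_U)=\Phi_{G(U)}$ and $\Phi_{M\otimes N}=\Phi_M\otimes\Phi_N$ for all objects $U,M,N$. No unit object is required. A hom-braiding $d$ in a hom-tensor category is a family of morphisms $d_{V,W}:V\otimes W\to G(W)\otimes G(V)$, natural in $V,W$ (i.e. $(G(g)\otimes G(f))\circ d_{V,W}=d_{V',W'}\circ(f\otimes g)$ for all $f:V\to V'$, $g:W\to W'$), not required to be invertible, with $G(d_{U,V})=d_{G(U),G(V)}$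 for all $U,V$, and satisfying for all objects $U,V,W$: (H1) $(\mathrm{id}_{FG(V)}\otimes(\mathrm{id}_{G(W)}\otimes\Phi_{G(U)}))\circ a_{G(V),G(W),G(U)}\circ d_{F(U),V\otimes W}\circ a_{U,V,W}=(\mathrm{id}_{FG(V)}\otimes d_{G(U),W})\circ a_{G(V),G(U),W}\circ(d_{U,V}\otimes\mathrm{id}_{F(W)})$; (H2) $((\Phi_{G(W)}\otimes\mathrm{id}_{G(U)})\otimes\mathrm{id}_{FG(V)})\circ a^{-1}_{G(W),G(U),G(V)}\circ d_{U\otimes V,F(W)}\circ a^{-1}_{U,V,W}=(d_{U,G(W)}\otimes\mathrm{id}_{FG(V)})\circ a^{-1}_{U,G(W),G(V)}\circ(\mathrm{id}_{F(U)}\otimes d_{V,W})$. A hom-braided category $(\mathcal{C},\otimes,F,G,a,\Phi,d)$ is a hom-tensor category with a hom-braiding $d$. A pre-tensor category $(\mathcal{C},\otimes,b)$ satisfies all the axioms of a tensor (monoidal) category except that no unit object is required. A quasi-braiding $c$ in it is a natural family of morphisms $c_{V,W}:V\otimes W\to W\otimes V$ (not required to be isomorphisms) satisfying the two hexagon axioms: $b_{V,W,U}\circ c_{U,V\otimes W}\circ b_{U,V,W}=(\mathrm{id}_V\otimes c_{U,W})\circ b_{V,U,W}\circ(c_{U,V}\otimes\mathrm{id}_W)$ and $b^{-1}_{W,U,V}\circ c_{U\otimes V,W}\circ b^{-1}_{U,V,W}=(c_{U,W}\otimes\mathrm{id}_V)\circ b^{-1}_{U,W,V}\circ(\mathrm{id}_U\otimes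 c_{V,W})$. Then $(\mathcal{C},\otimes,b,c)$ is called a quasi-braided (pre-tensor) category. *)

theory Defs
  imports Main
begin

text \<open>
  Categories live on arbitrary types, with explicit carrier sets of objects and arrows.
  All conditions are relativised to these carriers; values outside are irrelevant.
  Composition is written in the usual order, so \<open>g \<cdot> f\<close> means \<open>g\<close> after \<open>f\<close>,
  and \<open>\<one> X\<close> is the identity of \<open>X\<close>.
\<close>

record ('o, 'm) cat =
  Obj :: "'o set"
  Arr :: "'m set"
  Dom :: "'m \<Rightarrow> 'o"
  Cod :: "'m \<Rightarrow> 'o"
  Ident :: "'o \<Rightarrow> 'm" ("\<one>\<index>")
  Comp :: "'m \<Rightarrow> 'm \<Rightarrow> 'm" (infixr "\<cdot>\<index>" 55)

definition hom :: "('o, 'm, 'x) cat_scheme \<Rightarrow> 'o \<Rightarrow> 'o \<Rightarrow> 'm set" where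
  "hom C X Y = {f \<in> Arr C. Dom C f = X \<and> Cod C f = Y}"

locale category =
  fixes C :: "('o, 'm, 'x) cat_scheme" (structure)
  assumes Dom_in_Obj: "f \<in> Arr C \<Longrightarrow> Dom C f \<in> Obj C"
    and Cod_in_Obj: "f \<in> Arr C \<Longrightarrow> Cod C f \<in> Obj C"
    and Ident_in_hom: "X \<in> Obj C \<Longrightarrow> \<one> X \<in> hom C X X"
    and Comp_in_hom: "f \<in> hom C X Y \<Longrightarrow> g \<in> hom C Y Z \<Longrightarrow> g \<cdot> f \<in> hom C X Z"
    and Comp_Ident_left: "f \<in> hom C X Y \<Longrightarrow> \<one> Y \<cdot> f = f"
    and Comp_Ident_right: "f \<in> hom C X Y \<Longrightarrow> f \<cdot> \<one> X = f"
    and Comp_assoc: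
      "f \<in> hom C X Y \<Longrightarrow> g \<in> hom C Y Z \<Longrightarrow> h \<in> hom C Z W \<Longrightarrow> (h \<cdot> g) \<cdot> f = h \<cdot> (g \<cdot> f)"

definition inverse_arrows :: "('o, 'm, 'x) cat_scheme \<Rightarrow> 'm \<Rightarrow> 'm \<Rightarrow> bool" where
  "inverse_arrows C f g \<longleftrightarrow>
     f \<in> Arr C \<and> g \<in> hom C (Cod C f) (Dom C f) \<and>
     g \<cdot>\<^bsub>C\<^esub> f = \<one>\<^bsub>C\<^esub> (Dom C f) \<and> f \<cdot>\<^bsub>C\<^esub> g = \<one>\<^bsub>C\<^esub> (Cod C f)"

definition iso_arr :: "('o, 'm, 'x) cat_scheme \<Rightarrow> 'm \<Rightarrow> bool" where
  "iso_arr C f \<longleftrightarrow> (\<exists>g. inverse_arrows C f g)"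

definition inv_arr :: "('o, 'm, 'x) cat_scheme \<Rightarrow> 'm \<Rightarrow> 'm" ("_\<inverse>\<index>" [1000] 999) where
  "inv_arr C f = (THE g. inverse_arrows C f g)"

lemma (in category) inverse_arrows_unique:
  assumes "inverse_arrows C f g" and "inverse_arrows C f h"
  shows "g = h"
proof -
  let ?X = "Dom C f" and ?Y = "Cod C f"
  have f: "f \<in> hom C ?X ?Y" and g: "g \<in> hom C ?Y ?X" and h: "h \<in> hom C ?Y ?X"
    using assms by (auto simp: inverse_arrows_def hom_def)
  have "g = g \<cdot> (f \<cdot> h)"
    using Comp_Ident_right[OF g] assms(2) by (simp add: inverse_arrows_def)
  also have "\<dots> = (g \<cdot> f) \<cdot> h"
    using Comp_assoc[OF h f g] by simp
  also have "\<dots> = h"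
    using Comp_Ident_left[OF h] assms(1) by (simp add: inverse_arrows_def)
  finally show ?thesis .
qed

lemma (in category) inverse_arrows_inv_arr: "iso_arr C f \<Longrightarrow> inverse_arrows C f (f\<inverse>)"
  unfolding iso_arr_def inv_arr_def
  by (metis inverse_arrows_unique theI)

definition prod_cat ::
  "('o, 'm, 'x) cat_scheme \<Rightarrow> ('p, 'n, 'y) cat_scheme \<Rightarrow> ('o \<times> 'p, 'm \<times> 'n) cat"
  (infixr "\<times>\<^sub>c" 80) where
  "C \<times>\<^sub>c D =
     \<lparr> Obj = Obj C \<times> Obj D,
       Arr = Arr C \<times> Arr D,
       Dom = (\<lambda>(f, g). (Dom C f, Dom D g)),
       Cod = (\<lambda>(f, g). (Cod C f, Cod D g)),
       Ident = (\<lambda>(X, Y). (\<one>\<^bsub>C\<^esub> X, \<one>\<^bsub>D\<^esub> Y)),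
       Comp = (\<lambda>(f, g) (f', g'). (f \<cdot>\<^bsub>C\<^esub> f', g \<cdot>\<^bsub>D\<^esub> g')) \<rparr>"

text \<open>The action of a functor is \<open>F \<star> X\<close> on objects and \<open>F \<bullet> f\<close> on arrows.\<close>

record ('o, 'm, 'p, 'n) func =
  on_obj :: "'o \<Rightarrow> 'p" (infixr "\<star>" 90)
  on_arr :: "'m \<Rightarrow> 'n" (infixr "\<bullet>" 90)

definition id_func :: "('o, 'm, 'o, 'm) func" where
  "id_func = \<lparr> on_obj = (\<lambda>X. X), on_arr = (\<lambda>f. f) \<rparr>"

locale cat_functor = dom: category C + cod: category D
  for C :: "('o, 'm, 'x) cat_scheme" and D :: "('p, 'n, 'y) cat_scheme" +
  fixes F :: "('o, 'm, 'p, 'n) func"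
  assumes on_obj_in_Obj: "X \<in> Obj C \<Longrightarrow> F \<star> X \<in> Obj D"
    and on_arr_in_hom: "f \<in> hom C X Y \<Longrightarrow> F \<bullet> f \<in> hom D (F \<star> X) (F \<star> Y)"
    and on_arr_Ident: "X \<in> Obj C \<Longrightarrow> F \<bullet> (\<one>\<^bsub>C\<^esub> X) = \<one>\<^bsub>D\<^esub> (F \<star> X)"
    and on_arr_Comp: "f \<in> hom C X Y \<Longrightarrow> g \<in> hom C Y Z \<Longrightarrow>
      F \<bullet> (g \<cdot>\<^bsub>C\<^esub> f) = (F \<bullet> g) \<cdot>\<^bsub>D\<^esub> (F \<bullet> f)"

locale natural_transformation = source: cat_functor C D F + target: cat_functor C D G
  for C :: "('o, 'm, 'x) cat_scheme" and D :: "('p, 'n, 'y) cat_scheme"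
    and F G :: "('o, 'm, 'p, 'n) func" +
  fixes \<tau> :: "'o \<Rightarrow> 'n"
  assumes component_in_hom: "X \<in> Obj C \<Longrightarrow> \<tau> X \<in> hom D (F \<star> X) (G \<star> X)"
    and naturality: "f \<in> hom C X Y \<Longrightarrow> (G \<bullet> f) \<cdot>\<^bsub>D\<^esub> \<tau> X = \<tau> Y \<cdot>\<^bsub>D\<^esub> (F \<bullet> f)"

locale natural_isomorphism = natural_transformation +
  assumes component_iso: "X \<in> Obj C \<Longrightarrow> iso_arr D (\<tau> X)"

text \<open>
  A category with a tensor product, whose action is written \<open>X \<otimes> Y\<close> on objects
  and \<open>f \<boxtimes> g\<close> on arrows.
\<close>

record ('o, 'm) tensor_cat = "('o, 'm) cat" +
  tensor_obj :: "'o \<Rightarrow> 'o \<Rightarrow> 'o" (infixr "\<otimes>\<index>" 70)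
  tensor_arr :: "'m \<Rightarrow> 'm \<Rightarrow> 'm" (infixr "\<boxtimes>\<index>" 70)

definition tensor_func ::
  "('o, 'm, 'x) tensor_cat_scheme \<Rightarrow> ('o \<times> 'o, 'm \<times> 'm, 'o, 'm) func" where
  "tensor_func C = \<lparr> on_obj = (\<lambda>(X, Y). X \<otimes>\<^bsub>C\<^esub> Y), on_arr = (\<lambda>(f, g). f \<boxtimes>\<^bsub>C\<^esub> g) \<rparr>"

locale category_with_tensor =
  category C + tensor: cat_functor "C \<times>\<^sub>c C" C "tensor_func C"
  for C :: "('o, 'm, 'x) tensor_cat_scheme" (structure)

locale hom_tensor_category =
  category_with_tensor C + F: cat_functor C C F + G: cat_functor C C G
  for C :: "('o, 'm, 'x) tensor_cat_scheme" (structure)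
    and F G :: "('o, 'm, 'o, 'm) func" +
  fixes a :: "'o \<Rightarrow> 'o \<Rightarrow> 'o \<Rightarrow> 'm"
    and \<Phi> :: "'o \<Rightarrow> 'm"
  assumes F_tensor_obj: "U \<in> Obj C \<Longrightarrow> V \<in> Obj C \<Longrightarrow> F \<star> (U \<otimes> V) = (F \<star> U) \<otimes> (F \<star> V)"
    and F_tensor_arr: "f \<in> Arr C \<Longrightarrow> g \<in> Arr C \<Longrightarrow> F \<bullet> (f \<boxtimes> g) = (F \<bullet> f) \<boxtimes> (F \<bullet> g)"
    and G_tensor_obj: "U \<in> Obj C \<Longrightarrow> V \<in> Obj C \<Longrightarrow> G \<star> (U \<otimes> V) = (G \<star> U) \<otimes> (G \<star> V)"
    and G_tensor_arr: "f \<in> Arr C \<Longrightarrow> g \<in> Arr C \<Longrightarrow> G \<bullet> (f \<boxtimes> g) = (G \<bullet> f) \<boxtimes> (G \<bullet> g)"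
    and FG_obj: "U \<in> Obj C \<Longrightarrow> F \<star> G \<star> U = G \<star> F \<star> U"
    and FG_arr: "f \<in> Arr C \<Longrightarrow> F \<bullet> G \<bullet> f = G \<bullet> F \<bullet> f"
    and a_natural_isomorphism:
      "natural_isomorphism (C \<times>\<^sub>c C \<times>\<^sub>c C) C
         \<lparr> on_obj = (\<lambda>(X, Y, Z). (X \<otimes> Y) \<otimes> (F \<star> Z)),
           on_arr = (\<lambda>(f, g, h). (f \<boxtimes> g) \<boxtimes> (F \<bullet> h)) \<rparr>
         \<lparr> on_obj = (\<lambda>(X, Y, Z). (F \<star> X) \<otimes> (Y \<otimes> Z)),
           on_arr = (\<lambda>(f, g, h). (F \<bullet> f) \<boxtimes> (g \<boxtimes> h)) \<rparr>
         (\<lambda>(X, Y, Z). a X Y Z)"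
    and hom_pentagon:
      "\<lbrakk>X \<in> Obj C; Y \<in> Obj C; Z \<in> Obj C; T \<in> Obj C\<rbrakk> \<Longrightarrow>
         a (F \<star> X) (F \<star> Y) (Z \<otimes> T) \<cdot> a (X \<otimes> Y) (F \<star> Z) (F \<star> T)
         = (\<one> (F \<star> F \<star> X) \<boxtimes> a Y Z T) \<cdot> a (F \<star> X) (Y \<otimes> Z) (F \<star> T) \<cdot>
           (a X Y Z \<boxtimes> \<one> (F \<star> F \<star> T))"
    and \<Phi>_natural_transformation: "natural_transformation C C id_func G \<Phi>"
    and F_\<Phi>: "U \<in> Obj C \<Longrightarrow> F \<bullet> \<Phi> U = \<Phi> (F \<star> U)"
    and G_\<Phi>: "U \<in> Obj C \<Longrightarrow> G \<bullet> \<Phi> U = \<Phi> (G \<star> U)"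
    and \<Phi>_tensor: "M \<in> Obj C \<Longrightarrow> N \<in> Obj C \<Longrightarrow> \<Phi> (M \<otimes> N) = \<Phi> M \<boxtimes> \<Phi> N"

locale hom_braided_category = hom_tensor_category C F G a \<Phi>
  for C :: "('o, 'm, 'x) tensor_cat_scheme" (structure)
    and F G :: "('o, 'm, 'o, 'm) func"
    and a :: "'o \<Rightarrow> 'o \<Rightarrow> 'o \<Rightarrow> 'm"
    and \<Phi> :: "'o \<Rightarrow> 'm" +
  fixes d :: "'o \<Rightarrow> 'o \<Rightarrow> 'm"
  assumes d_natural_transformation:
      "natural_transformation (C \<times>\<^sub>c C) C (tensor_func C)
         \<lparr> on_obj = (\<lambda>(V, W). (G \<star> W) \<otimes> (G \<star> V)),
           on_arr = (\<lambda>(f, g). (G \<bullet> g) \<boxtimes> (G \<bullet> f)) \<rparr>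
         (\<lambda>(V, W). d V W)"
    and G_d: "U \<in> Obj C \<Longrightarrow> V \<in> Obj C \<Longrightarrow> G \<bullet> d U V = d (G \<star> U) (G \<star> V)"
    and H1: "\<lbrakk>U \<in> Obj C; V \<in> Obj C; W \<in> Obj C\<rbrakk> \<Longrightarrow>
         (\<one> (F \<star> G \<star> V) \<boxtimes> (\<one> (G \<star> W) \<boxtimes> \<Phi> (G \<star> U))) \<cdot>
           a (G \<star> V) (G \<star> W) (G \<star> U) \<cdot> d (F \<star> U) (V \<otimes> W) \<cdot> a U V W
         = (\<one> (F \<star> G \<star> V) \<boxtimes> d (G \<star> U) W) \<cdot> a (G \<star> V) (G \<star> U) W \<cdot> (d U V \<boxtimes> \<one> (F \<star> W))"
    and H2: "\<lbrakk>U \<in> Obj C; V \<in> Obj C; W \<in> Obj C\<rbrakk> \<Longrightarrow>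
         ((\<Phi> (G \<star> W) \<boxtimes> \<one> (G \<star> U)) \<boxtimes> \<one> (F \<star> G \<star> V)) \<cdot>
           (a (G \<star> W) (G \<star> U) (G \<star> V))\<inverse> \<cdot> d (U \<otimes> V) (F \<star> W) \<cdot> (a U V W)\<inverse>
         = (d U (G \<star> W) \<boxtimes> \<one> (F \<star> G \<star> V)) \<cdot> (a U (G \<star> W) (G \<star> V))\<inverse> \<cdot>
           (\<one> (F \<star> U) \<boxtimes> d V W)"

locale pre_tensor_category = category_with_tensor C
  for C :: "('o, 'm, 'x) tensor_cat_scheme" (structure) +
  fixes b :: "'o \<Rightarrow> 'o \<Rightarrow> 'o \<Rightarrow> 'm"
  assumes b_natural_isomorphism:
      "natural_isomorphism (C \<times>\<^sub>c C \<times>\<^sub>c C) C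
         \<lparr> on_obj = (\<lambda>(U, V, W). (U \<otimes> V) \<otimes> W),
           on_arr = (\<lambda>(f, g, h). (f \<boxtimes> g) \<boxtimes> h) \<rparr>
         \<lparr> on_obj = (\<lambda>(U, V, W). U \<otimes> (V \<otimes> W)),
           on_arr = (\<lambda>(f, g, h). f \<boxtimes> (g \<boxtimes> h)) \<rparr>
         (\<lambda>(U, V, W). b U V W)"
    and pentagon:
      "\<lbrakk>X \<in> Obj C; Y \<in> Obj C; Z \<in> Obj C; T \<in> Obj C\<rbrakk> \<Longrightarrow>
         b X Y (Z \<otimes> T) \<cdot> b (X \<otimes> Y) Z T
         = (\<one> X \<boxtimes> b Y Z T) \<cdot> b X (Y \<otimes> Z) T \<cdot> (b X Y Z \<boxtimes> \<one> T)"

locale quasi_braided_category = pre_tensor_category C b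
  for C :: "('o, 'm, 'x) tensor_cat_scheme" (structure)
    and b :: "'o \<Rightarrow> 'o \<Rightarrow> 'o \<Rightarrow> 'm" +
  fixes c :: "'o \<Rightarrow> 'o \<Rightarrow> 'm"
  assumes c_natural_transformation:
      "natural_transformation (C \<times>\<^sub>c C) C (tensor_func C)
         \<lparr> on_obj = (\<lambda>(V, W). W \<otimes> V), on_arr = (\<lambda>(f, g). g \<boxtimes> f) \<rparr>
         (\<lambda>(V, W). c V W)"
    and hexagon1: "\<lbrakk>U \<in> Obj C; V \<in> Obj C; W \<in> Obj C\<rbrakk> \<Longrightarrow>
         b V W U \<cdot> c U (V \<otimes> W) \<cdot> b U V W
         = (\<one> V \<boxtimes> c U W) \<cdot> b V U W \<cdot> (c U V \<boxtimes> \<one> W)"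
    and hexagon2: "\<lbrakk>U \<in> Obj C; V \<in> Obj C; W \<in> Obj C\<rbrakk> \<Longrightarrow>
         (b W U V)\<inverse> \<cdot> c (U \<otimes> V) W \<cdot> (b U V W)\<inverse>
         = (c U W \<boxtimes> \<one> V) \<cdot> (b U W V)\<inverse> \<cdot> (\<one> U \<boxtimes> c V W)"

end

theory Submission
  imports Defs
begin

text \<open>
  The isomorphism \<open>\<Theta>\<close> identifies \<open>F\<close> with the identity functor and \<open>\<Phi>\<close> identifies \<open>G\<close> with it.
  Under these identifications \<open>b\<close> is \<open>a\<close> and \<open>c\<close> is \<open>d\<close>, and the axioms of a hom-braided category
  become those of a quasi-braided one.  Everything rests on two families of commuting squares,
  valid for all arrows \<open>f : U \<rightarrow> U'\<close>, \<open>g : V \<rightarrow> V'\<close>, \<open>h : W \<rightarrow> W'\<close>, from which the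
  actions of \<open>F\<close> and \<open>G\<close> on arrows are eliminated by naturality of \<open>\<Theta>\<close> and \<open>\<Phi>\<close>:
  \<open>((\<Theta> U' \<cdot> f) \<boxtimes> (g \<boxtimes> h)) \<cdot> b U V W = a U' V' W' \<cdot> ((f \<boxtimes> g) \<boxtimes> (\<Theta> W' \<cdot> h))\<close>
  (\<open>b_square\<close>) and
  \<open>((\<Phi> V' \<cdot> g) \<boxtimes> (\<Phi> U' \<cdot> f)) \<cdot> c U V = d U' V' \<cdot> (f \<boxtimes> g)\<close> (\<open>c_square\<close>).

  To prove the pentagon or a hexagon, both sides of the required equation are continued by
  one invertible arrow built from \<open>\<Theta>\<close> and \<open>\<Phi>\<close>.  Pasting squares carries that arrow through
  to the source, turning every \<open>b\<close> into an \<open>a\<close> and every \<open>c\<close> into a \<open>d\<close> on the way.  The two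
  results agree by the corresponding axiom of the hom-braided category, and
  the invertible arrow is cancelled.  The objects at which \<open>a\<close> and \<open>d\<close> must end up dictate that
  arrow; for instance the pentagon takes \<open>(\<Theta> (F \<star> X) \<cdot> \<Theta> X) \<boxtimes> (\<Theta> Y \<boxtimes> \<one> (Z \<otimes> T))\<close>.
\<close>

(* Postfix inverse otherwise also denotes the converse of a relation. *)
unbundle no converse_syntax

section \<open>Composition and isomorphisms\<close>

text \<open>
  The axioms of a category are stated with hom-sets, which mention an intermediate object that
  rewriting cannot guess.  With \<open>Dom\<close> and \<open>Cod\<close> as functions they become conditional
  rewrite rules, so that typing conditions are discharged by simplification.
\<close>

context category
begin

lemma Dom_Obj [simp]: "f \<in> Arr C \<Longrightarrow> Dom C f \<in> Obj C"
  and Cod_Obj [simp]: "f \<in> Arr C \<Longrightarrow> Cod C f \<in> Obj C"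
  by (fact Dom_in_Obj Cod_in_Obj)+

lemma Ident_typing [simp]:
  assumes "X \<in> Obj C"
  shows "\<one> X \<in> Arr C" "Dom C (\<one> X) = X" "Cod C (\<one> X) = X"
  using Ident_in_hom[OF assms] by (auto simp: hom_def)

lemma Comp_typing [simp]:
  assumes "f \<in> Arr C" "g \<in> Arr C" "Dom C g = Cod C f"
  shows "g \<cdot> f \<in> Arr C" "Dom C (g \<cdot> f) = Dom C f" "Cod C (g \<cdot> f) = Cod C g"
  using Comp_in_hom[of f "Dom C f" "Cod C f" g "Cod C g"] assms by (auto simp: hom_def)

lemma Ident_Comp [simp]: "f \<in> Arr C \<Longrightarrow> Cod C f = Y \<Longrightarrow> \<one> Y \<cdot> f = f"
  using Comp_Ident_left by (auto simp: hom_def)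

lemma Comp_Ident [simp]: "f \<in> Arr C \<Longrightarrow> Dom C f = X \<Longrightarrow> f \<cdot> \<one> X = f"
  using Comp_Ident_right by (auto simp: hom_def)

lemma Comp_assoc_Arr [simp]:
  "\<lbrakk>f \<in> Arr C; g \<in> Arr C; h \<in> Arr C; Dom C g = Cod C f; Dom C h = Cod C g\<rbrakk> \<Longrightarrow>
     (h \<cdot> g) \<cdot> f = h \<cdot> (g \<cdot> f)"
  using Comp_assoc by (auto simp: hom_def)

lemma paste_squares:
  assumes "p \<cdot> q = r \<cdot> s" "s \<cdot> k = t \<cdot> u"
    and "{p, q, r, s, k, t, u} \<subseteq> Arr C"
    and "Dom C p = Cod C q" "Dom C r = Cod C s" "Dom C q = Cod C k" "Dom C t = Cod C u"
      "Dom C s = Cod C k" "Dom C r = Cod C t"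
  shows "p \<cdot> (q \<cdot> k) = r \<cdot> (t \<cdot> u)"
proof -
  have "p \<cdot> (q \<cdot> k) = (p \<cdot> q) \<cdot> k" using assms(3-) by simp
  also have "\<dots> = r \<cdot> (s \<cdot> k)" using assms(1,3-) by simp
  finally show ?thesis using assms(2) by simp
qed

lemma iso_arr_Arr: "iso_arr C f \<Longrightarrow> f \<in> Arr C"
  by (auto simp: iso_arr_def inverse_arrows_def)

lemma inv_arr_typing [simp]:
  assumes "iso_arr C f"
  shows "f\<inverse> \<in> Arr C" "Dom C (f\<inverse>) = Cod C f" "Cod C (f\<inverse>) = Dom C f"
  using inverse_arrows_inv_arr[OF assms] by (auto simp: inverse_arrows_def hom_def)

lemma inv_arr_Comp [simp]:
  assumes "iso_arr C f"
  shows "f\<inverse> \<cdot> f = \<one> (Dom C f)" "f \<cdot> f\<inverse> = \<one> (Cod C f)"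
  using inverse_arrows_inv_arr[OF assms] by (auto simp: inverse_arrows_def)

lemma iso_arrI:
  assumes "f \<in> Arr C" "g \<in> Arr C" "Dom C g = Cod C f" "Cod C g = Dom C f"
    and "g \<cdot> f = \<one> (Dom C f)" "f \<cdot> g = \<one> (Cod C f)"
  shows "iso_arr C f"
  using assms by (auto simp: iso_arr_def inverse_arrows_def hom_def)

lemma iso_arr_Ident [simp]: "X \<in> Obj C \<Longrightarrow> iso_arr C (\<one> X)"
  by (rule iso_arrI[of _ "\<one> X"]) auto

lemma iso_arr_inv_arr [simp]: "iso_arr C f \<Longrightarrow> iso_arr C (f\<inverse>)"
  by (rule iso_arrI[of _ f]) (auto simp: iso_arr_Arr)

lemma inv_arr_Comp_left [simp]:
  assumes "iso_arr C f" "g \<in> Arr C" "Cod C g = Dom C f"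
  shows "f\<inverse> \<cdot> (f \<cdot> g) = g"
  using Comp_assoc_Arr[of g f "f\<inverse>"] assms by (simp add: iso_arr_Arr)

lemma Comp_inv_arr_left [simp]:
  assumes "iso_arr C f" "g \<in> Arr C" "Cod C g = Cod C f"
  shows "f \<cdot> (f\<inverse> \<cdot> g) = g"
  using Comp_assoc_Arr[of g "f\<inverse>" f] assms by (simp add: iso_arr_Arr)

lemma iso_arr_Comp [simp]:
  assumes "iso_arr C f" "iso_arr C g" "Dom C g = Cod C f"
  shows "iso_arr C (g \<cdot> f)"
  by (rule iso_arrI[of _ "f\<inverse> \<cdot> g\<inverse>"]) (use assms in \<open>auto simp: iso_arr_Arr\<close>)

lemma iso_arr_cancel:
  assumes "iso_arr C m" "m \<cdot> f = m \<cdot> g"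
    and "f \<in> Arr C" "g \<in> Arr C" "Cod C f = Dom C m" "Cod C g = Dom C m"
  shows "f = g"
  using assms inv_arr_Comp_left by metis

text \<open>The mate of a commuting square under inversion of two opposite sides.\<close>

lemma inverse_square:
  assumes "p \<cdot> q = r \<cdot> s" "iso_arr C q" "iso_arr C r"
    and "p \<in> Arr C" "s \<in> Arr C" "Dom C p = Cod C q" "Dom C r = Cod C s" "Dom C q = Dom C s"
      "Cod C p = Cod C r"
  shows "s \<cdot> q\<inverse> = r\<inverse> \<cdot> p"
proof (rule iso_arr_cancel[OF assms(3)])
  have "r \<cdot> (s \<cdot> q\<inverse>) = (p \<cdot> q) \<cdot> q\<inverse>"
    using assms by (simp add: iso_arr_Arr)
  also have "\<dots> = p"
    using assms(2,4-) by (simp add: iso_arr_Arr)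
  finally show "r \<cdot> (s \<cdot> q\<inverse>) = r \<cdot> (r\<inverse> \<cdot> p)"
    using assms by (simp add: iso_arr_Arr)
qed (use assms in \<open>auto simp: iso_arr_Arr\<close>)

end

section \<open>The tensor product on arrows\<close>

context category_with_tensor
begin

lemma tensor_Obj [simp]: "X \<in> Obj C \<Longrightarrow> Y \<in> Obj C \<Longrightarrow> X \<otimes> Y \<in> Obj C"
  using tensor.on_obj_in_Obj[of "(X, Y)"] by (simp add: prod_cat_def tensor_func_def)

lemma tensor_typing [simp]:
  assumes "f \<in> Arr C" "g \<in> Arr C"
  shows "f \<boxtimes> g \<in> Arr C" "Dom C (f \<boxtimes> g) = Dom C f \<otimes> Dom C g"
    "Cod C (f \<boxtimes> g) = Cod C f \<otimes> Cod C g"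
  using tensor.on_arr_in_hom[of "(f, g)" "(Dom C f, Dom C g)" "(Cod C f, Cod C g)"] assms
  by (auto simp: prod_cat_def tensor_func_def hom_def)

lemma tensor_Ident [simp]: "X \<in> Obj C \<Longrightarrow> Y \<in> Obj C \<Longrightarrow> \<one> X \<boxtimes> \<one> Y = \<one> (X \<otimes> Y)"
  using tensor.on_arr_Ident[of "(X, Y)"] by (simp add: prod_cat_def tensor_func_def)

lemma interchange [simp]:
  assumes "{f, g, f', g'} \<subseteq> Arr C" "Dom C f' = Cod C f" "Dom C g' = Cod C g"
  shows "(f' \<boxtimes> g') \<cdot> (f \<boxtimes> g) = (f' \<cdot> f) \<boxtimes> (g' \<cdot> g)"
  using tensor.on_arr_Comp[of "(f, g)" "(Dom C f, Dom C g)" "(Cod C f, Cod C g)"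
      "(f', g')" "(Cod C f', Cod C g')"] assms
  by (auto simp: prod_cat_def tensor_func_def hom_def)

text \<open>
  Composites are kept associated to the right, which hides adjacent tensor products from the
  interchange law; this variant merges them as well.
\<close>

lemma interchange_Comp [simp]:
  assumes "{f, g, f', g', k} \<subseteq> Arr C" "Dom C f' = Cod C f" "Dom C g' = Cod C g"
    and "Cod C k = Dom C f \<otimes> Dom C g"
  shows "(f' \<boxtimes> g') \<cdot> ((f \<boxtimes> g) \<cdot> k) = ((f' \<cdot> f) \<boxtimes> (g' \<cdot> g)) \<cdot> k"
proof -
  have "(f' \<boxtimes> g') \<cdot> ((f \<boxtimes> g) \<cdot> k) = ((f' \<boxtimes> g') \<cdot> (f \<boxtimes> g)) \<cdot> k"
    using assms by (subst Comp_assoc_Arr) auto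
  then show ?thesis using assms by simp
qed

lemma iso_arr_tensor [simp]: "iso_arr C f \<Longrightarrow> iso_arr C g \<Longrightarrow> iso_arr C (f \<boxtimes> g)"
  by (rule iso_arrI[of _ "f\<inverse> \<boxtimes> g\<inverse>"]) (auto simp: iso_arr_Arr)

end

section \<open>Structure of a hom-tensor category, componentwise\<close>

context hom_tensor_category
begin

lemma F_Obj [simp]: "X \<in> Obj C \<Longrightarrow> F \<star> X \<in> Obj C"
  and G_Obj [simp]: "X \<in> Obj C \<Longrightarrow> G \<star> X \<in> Obj C"
  by (fact F.on_obj_in_Obj G.on_obj_in_Obj)+

lemma F_typing [simp]:
  assumes "f \<in> Arr C"
  shows "F \<bullet> f \<in> Arr C" "Dom C (F \<bullet> f) = F \<star> Dom C f" "Cod C (F \<bullet> f) = F \<star> Cod C f"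
  using F.on_arr_in_hom[of f "Dom C f" "Cod C f"] assms by (auto simp: hom_def)

lemma G_typing [simp]:
  assumes "f \<in> Arr C"
  shows "G \<bullet> f \<in> Arr C" "Dom C (G \<bullet> f) = G \<star> Dom C f" "Cod C (G \<bullet> f) = G \<star> Cod C f"
  using G.on_arr_in_hom[of f "Dom C f" "Cod C f"] assms by (auto simp: hom_def)

lemmas tensor_simps [simp] = F_tensor_obj G_tensor_obj FG_obj \<Phi>_tensor

lemma a_iso [simp]:
  "X \<in> Obj C \<Longrightarrow> Y \<in> Obj C \<Longrightarrow> Z \<in> Obj C \<Longrightarrow> iso_arr C (a X Y Z)"
  using natural_isomorphism.component_iso[OF a_natural_isomorphism, of "(X, Y, Z)"]
  by (simp add: prod_cat_def)

lemma a_typing [simp]: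
  assumes "X \<in> Obj C" "Y \<in> Obj C" "Z \<in> Obj C"
  shows "a X Y Z \<in> Arr C" "Dom C (a X Y Z) = (X \<otimes> Y) \<otimes> (F \<star> Z)"
    "Cod C (a X Y Z) = (F \<star> X) \<otimes> (Y \<otimes> Z)"
  using natural_transformation.component_in_hom[OF
      natural_isomorphism.axioms(1)[OF a_natural_isomorphism], of "(X, Y, Z)"] assms
  by (auto simp: prod_cat_def hom_def)

lemma a_natural:
  assumes "f \<in> Arr C" "g \<in> Arr C" "h \<in> Arr C"
  shows "((F \<bullet> f) \<boxtimes> (g \<boxtimes> h)) \<cdot> a (Dom C f) (Dom C g) (Dom C h)
       = a (Cod C f) (Cod C g) (Cod C h) \<cdot> ((f \<boxtimes> g) \<boxtimes> (F \<bullet> h))"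
  using natural_transformation.naturality[OF
      natural_isomorphism.axioms(1)[OF a_natural_isomorphism], of "(f, g, h)"
      "(Dom C f, Dom C g, Dom C h)" "(Cod C f, Cod C g, Cod C h)"] assms
  by (auto simp: prod_cat_def hom_def)

lemma \<Phi>_typing [simp]:
  assumes "U \<in> Obj C"
  shows "\<Phi> U \<in> Arr C" "Dom C (\<Phi> U) = U" "Cod C (\<Phi> U) = G \<star> U"
  using natural_transformation.component_in_hom[OF \<Phi>_natural_transformation assms]
  by (auto simp: hom_def id_func_def)

lemma \<Phi>_natural: "f \<in> Arr C \<Longrightarrow> (G \<bullet> f) \<cdot> \<Phi> (Dom C f) = \<Phi> (Cod C f) \<cdot> f"
  using natural_transformation.naturality[OF \<Phi>_natural_transformation, of f "Dom C f" "Cod C f"]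
  by (simp add: hom_def id_func_def)

end

context hom_braided_category
begin

lemma d_typing [simp]:
  assumes "V \<in> Obj C" "W \<in> Obj C"
  shows "d V W \<in> Arr C" "Dom C (d V W) = V \<otimes> W" "Cod C (d V W) = (G \<star> W) \<otimes> (G \<star> V)"
  using natural_transformation.component_in_hom[OF d_natural_transformation, of "(V, W)"] assms
  by (auto simp: prod_cat_def hom_def tensor_func_def)

lemma d_natural:
  assumes "f \<in> Arr C" "g \<in> Arr C"
  shows "((G \<bullet> g) \<boxtimes> (G \<bullet> f)) \<cdot> d (Dom C f) (Dom C g) = d (Cod C f) (Cod C g) \<cdot> (f \<boxtimes> g)"
  using natural_transformation.naturality[OF d_natural_transformation, of "(f, g)"
      "(Dom C f, Dom C g)" "(Cod C f, Cod C g)"] assms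
  by (auto simp: prod_cat_def hom_def tensor_func_def)

end

section \<open>Trivializing F: the pre-tensor category\<close>

locale F_trivialized = hom_tensor_category C F G a \<Phi>
  for C :: "('o, 'm, 'x) tensor_cat_scheme" (structure)
    and F G :: "('o, 'm, 'o, 'm) func"
    and a :: "'o \<Rightarrow> 'o \<Rightarrow> 'o \<Rightarrow> 'm"
    and \<Phi> :: "'o \<Rightarrow> 'm" +
  fixes \<Theta> :: "'o \<Rightarrow> 'm" and b :: "'o \<Rightarrow> 'o \<Rightarrow> 'o \<Rightarrow> 'm"
  assumes \<Theta>_natural_isomorphism: "natural_isomorphism C C id_func F \<Theta>"
    and \<Theta>_tensor [simp]: "M \<in> Obj C \<Longrightarrow> N \<in> Obj C \<Longrightarrow> \<Theta> (M \<otimes> N) = \<Theta> M \<boxtimes> \<Theta> N"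
    and b_eq: "\<lbrakk>U \<in> Obj C; V \<in> Obj C; W \<in> Obj C\<rbrakk> \<Longrightarrow>
      b U V W = ((\<Theta> U)\<inverse> \<boxtimes> \<one> (V \<otimes> W)) \<cdot> a U V W \<cdot> (\<one> (U \<otimes> V) \<boxtimes> \<Theta> W)"
begin

lemma \<Theta>_iso [simp]: "U \<in> Obj C \<Longrightarrow> iso_arr C (\<Theta> U)"
  using natural_isomorphism.component_iso[OF \<Theta>_natural_isomorphism] .

lemma \<Theta>_typing [simp]:
  assumes "U \<in> Obj C"
  shows "\<Theta> U \<in> Arr C" "Dom C (\<Theta> U) = U" "Cod C (\<Theta> U) = F \<star> U"
  using natural_transformation.component_in_hom[OF
      natural_isomorphism.axioms(1)[OF \<Theta>_natural_isomorphism] assms]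
  by (auto simp: hom_def id_func_def)

lemma \<Theta>_natural: "f \<in> Arr C \<Longrightarrow> (F \<bullet> f) \<cdot> \<Theta> (Dom C f) = \<Theta> (Cod C f) \<cdot> f"
  using natural_transformation.naturality[OF
      natural_isomorphism.axioms(1)[OF \<Theta>_natural_isomorphism], of f "Dom C f" "Cod C f"]
  by (simp add: hom_def id_func_def)

lemma b_typing [simp]:
  assumes "U \<in> Obj C" "V \<in> Obj C" "W \<in> Obj C"
  shows "b U V W \<in> Arr C" "Dom C (b U V W) = (U \<otimes> V) \<otimes> W" "Cod C (b U V W) = U \<otimes> (V \<otimes> W)"
  using assms by (auto simp: b_eq)

lemma b_iso [simp]: "U \<in> Obj C \<Longrightarrow> V \<in> Obj C \<Longrightarrow> W \<in> Obj C \<Longrightarrow> iso_arr C (b U V W)"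
  by (auto simp: b_eq)

text \<open>
  For identities \<open>f\<close>, \<open>g\<close>, \<open>h\<close> this is the definition of \<open>b\<close>, with the inverse of \<open>\<Theta>\<close> moved to the
  other side.  The general square pastes this one with naturality of \<open>a\<close>; since
  \<open>F \<bullet> f\<close> and \<open>F \<bullet> h\<close> enter only next to \<open>\<Theta>\<close>, naturality of \<open>\<Theta>\<close> eliminates them.
\<close>

lemma b_square:
  assumes "f \<in> hom C U U'" "g \<in> hom C V V'" "h \<in> hom C W W'"
  shows "((\<Theta> U' \<cdot> f) \<boxtimes> (g \<boxtimes> h)) \<cdot> b U V W = a U' V' W' \<cdot> ((f \<boxtimes> g) \<boxtimes> (\<Theta> W' \<cdot> h))"
proof -
  have [simp]: "f \<in> Arr C" "g \<in> Arr C" "h \<in> Arr C" "Dom C f = U" "Cod C f = U'"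
    "Dom C g = V" "Cod C g = V'" "Dom C h = W" "Cod C h = W'"
    using assms by (auto simp: hom_def)
  have [simp]: "U \<in> Obj C" "V \<in> Obj C" "W \<in> Obj C" "U' \<in> Obj C" "V' \<in> Obj C" "W' \<in> Obj C"
    using Dom_Obj[of f] Dom_Obj[of g] Dom_Obj[of h] Cod_Obj[of f] Cod_Obj[of g] Cod_Obj[of h]
    by simp_all
  have "((\<Theta> U' \<cdot> f) \<boxtimes> (g \<boxtimes> h)) \<cdot> b U V W
      = (((F \<bullet> f) \<boxtimes> (g \<boxtimes> h)) \<cdot> (\<Theta> U \<boxtimes> \<one> (V \<otimes> W))) \<cdot> b U V W"
    using \<Theta>_natural[of f] by simp
  also have "\<dots> = ((F \<bullet> f) \<boxtimes> (g \<boxtimes> h)) \<cdot> (a U V W \<cdot> (\<one> (U \<otimes> V) \<boxtimes> \<Theta> W))"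
    by (subst Comp_assoc_Arr) (simp_all add: b_eq)
  also have "\<dots> = a U' V' W' \<cdot> ((f \<boxtimes> g) \<boxtimes> (F \<bullet> h \<cdot> \<Theta> W))"
  proof (rule trans[OF paste_squares[OF a_natural[of f g h, simplified] refl]])
    show "a U' V' W' \<cdot> ((f \<boxtimes> g) \<boxtimes> F \<bullet> h) \<cdot> (\<one> (U \<otimes> V) \<boxtimes> \<Theta> W)
      = a U' V' W' \<cdot> ((f \<boxtimes> g) \<boxtimes> (F \<bullet> h \<cdot> \<Theta> W))" by simp
  qed simp_all
  also have "F \<bullet> h \<cdot> \<Theta> W = \<Theta> W' \<cdot> h"
    using \<Theta>_natural[of h] by simp
  finally show ?thesis .
qed

lemma b_inverse_square:
  assumes "f \<in> hom C U U'" "g \<in> hom C V V'" "h \<in> hom C W W'"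
  shows "((f \<boxtimes> g) \<boxtimes> (\<Theta> W' \<cdot> h)) \<cdot> (b U V W)\<inverse> = (a U' V' W')\<inverse> \<cdot> ((\<Theta> U' \<cdot> f) \<boxtimes> (g \<boxtimes> h))"
proof -
  have [simp]: "f \<in> Arr C" "g \<in> Arr C" "h \<in> Arr C" "Dom C f = U" "Cod C f = U'"
    "Dom C g = V" "Cod C g = V'" "Dom C h = W" "Cod C h = W'"
    using assms by (auto simp: hom_def)
  have [simp]: "U \<in> Obj C" "V \<in> Obj C" "W \<in> Obj C" "U' \<in> Obj C" "V' \<in> Obj C" "W' \<in> Obj C"
    using Dom_Obj[of f] Dom_Obj[of g] Dom_Obj[of h] Cod_Obj[of f] Cod_Obj[of g] Cod_Obj[of h]
    by simp_all
  show ?thesis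
    by (rule inverse_square[OF b_square[OF assms]]) simp_all
qed

lemma b_natural:
  assumes "f \<in> hom C U U'" "g \<in> hom C V V'" "h \<in> hom C W W'"
  shows "(f \<boxtimes> (g \<boxtimes> h)) \<cdot> b U V W = b U' V' W' \<cdot> ((f \<boxtimes> g) \<boxtimes> h)"
proof -
  have [simp]: "f \<in> Arr C" "g \<in> Arr C" "h \<in> Arr C" "Dom C f = U" "Cod C f = U'"
    "Dom C g = V" "Cod C g = V'" "Dom C h = W" "Cod C h = W'"
    using assms by (auto simp: hom_def)
  have [simp]: "U \<in> Obj C" "V \<in> Obj C" "W \<in> Obj C" "U' \<in> Obj C" "V' \<in> Obj C" "W' \<in> Obj C"
    using Dom_Obj[of f] Dom_Obj[of g] Dom_Obj[of h] Cod_Obj[of f] Cod_Obj[of g] Cod_Obj[of h]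
    by simp_all
  let ?m = "\<Theta> U' \<boxtimes> \<one> (V' \<otimes> W')"
  show ?thesis
  proof (rule iso_arr_cancel[of ?m])
    have "?m \<cdot> ((f \<boxtimes> (g \<boxtimes> h)) \<cdot> b U V W) = a U' V' W' \<cdot> ((f \<boxtimes> g) \<boxtimes> (\<Theta> W' \<cdot> h))"
      using b_square[OF assms] by simp
    also have "\<dots> = ?m \<cdot> (b U' V' W' \<cdot> ((f \<boxtimes> g) \<boxtimes> h))"
      by (simp add: b_eq)
    finally show "?m \<cdot> ((f \<boxtimes> (g \<boxtimes> h)) \<cdot> b U V W) = ?m \<cdot> (b U' V' W' \<cdot> ((f \<boxtimes> g) \<boxtimes> h))" .
  qed simp_all
qed

text \<open>
  The arrow \<open>\<Theta> (F \<star> X) \<cdot> \<Theta> X\<close> trivializes \<open>F \<star> F \<star> X\<close>.  Both sides of the pentagon for \<open>b\<close>, followed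
  by \<open>?m\<close>, are the corresponding sides of the pentagon for \<open>a\<close>, preceded by \<open>?n\<close>.
\<close>

lemma b_pentagon:
  assumes [simp]: "X \<in> Obj C" "Y \<in> Obj C" "Z \<in> Obj C" "T \<in> Obj C"
  shows "b X Y (Z \<otimes> T) \<cdot> b (X \<otimes> Y) Z T
       = (\<one> X \<boxtimes> b Y Z T) \<cdot> b X (Y \<otimes> Z) T \<cdot> (b X Y Z \<boxtimes> \<one> T)"
proof -
  let ?TX = "\<Theta> (F \<star> X) \<cdot> \<Theta> X" and ?TT = "\<Theta> (F \<star> T) \<cdot> \<Theta> T"
  let ?m = "?TX \<boxtimes> (\<Theta> Y \<boxtimes> \<one> (Z \<otimes> T))" and ?n = "(\<one> (X \<otimes> Y) \<boxtimes> \<Theta> Z) \<boxtimes> ?TT"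
  have l1: "?m \<cdot> b X Y (Z \<otimes> T)
      = a (F \<star> X) (F \<star> Y) (Z \<otimes> T) \<cdot> ((\<Theta> X \<boxtimes> \<Theta> Y) \<boxtimes> (\<Theta> Z \<boxtimes> \<Theta> T))"
    using b_square[of "\<Theta> X" X "F \<star> X" "\<Theta> Y" Y "F \<star> Y" "\<one> (Z \<otimes> T)" "Z \<otimes> T" "Z \<otimes> T"]
    by (simp add: hom_def)
  have l2: "((\<Theta> X \<boxtimes> \<Theta> Y) \<boxtimes> (\<Theta> Z \<boxtimes> \<Theta> T)) \<cdot> b (X \<otimes> Y) Z T = a (X \<otimes> Y) (F \<star> Z) (F \<star> T) \<cdot> ?n"
    using b_square[of "\<one> (X \<otimes> Y)" "X \<otimes> Y" "X \<otimes> Y" "\<Theta> Z" Z "F \<star> Z" "\<Theta> T" T "F \<star> T"]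
    by (simp add: hom_def)
  have l: "?m \<cdot> (b X Y (Z \<otimes> T) \<cdot> b (X \<otimes> Y) Z T)
      = a (F \<star> X) (F \<star> Y) (Z \<otimes> T) \<cdot> (a (X \<otimes> Y) (F \<star> Z) (F \<star> T) \<cdot> ?n)"
    by (rule paste_squares[OF l1 l2]) simp_all
  have bY: "(\<Theta> Y \<boxtimes> \<one> (Z \<otimes> T)) \<cdot> b Y Z T = a Y Z T \<cdot> (\<one> (Y \<otimes> Z) \<boxtimes> \<Theta> T)"
    and bX: "(\<Theta> X \<boxtimes> \<one> (Y \<otimes> Z)) \<cdot> b X Y Z = a X Y Z \<cdot> (\<one> (X \<otimes> Y) \<boxtimes> \<Theta> Z)"
    by (simp_all add: b_eq)
  have r1: "?m \<cdot> (\<one> X \<boxtimes> b Y Z T)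
      = (\<one> (F \<star> F \<star> X) \<boxtimes> a Y Z T) \<cdot> (?TX \<boxtimes> (\<one> (Y \<otimes> Z) \<boxtimes> \<Theta> T))"
    using bY by simp
  have r2: "(?TX \<boxtimes> (\<one> (Y \<otimes> Z) \<boxtimes> \<Theta> T)) \<cdot> b X (Y \<otimes> Z) T
      = a (F \<star> X) (Y \<otimes> Z) (F \<star> T) \<cdot> ((\<Theta> X \<boxtimes> \<one> (Y \<otimes> Z)) \<boxtimes> ?TT)"
    using b_square[of "\<Theta> X" X "F \<star> X" "\<one> (Y \<otimes> Z)" "Y \<otimes> Z" "Y \<otimes> Z" "\<Theta> T" T "F \<star> T"]
    by (simp add: hom_def)
  have r3: "((\<Theta> X \<boxtimes> \<one> (Y \<otimes> Z)) \<boxtimes> ?TT) \<cdot> (b X Y Z \<boxtimes> \<one> T) = (a X Y Z \<boxtimes> \<one> (F \<star> F \<star> T)) \<cdot> ?n"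
    using bX by simp
  have r23: "(?TX \<boxtimes> (\<one> (Y \<otimes> Z) \<boxtimes> \<Theta> T)) \<cdot> (b X (Y \<otimes> Z) T \<cdot> (b X Y Z \<boxtimes> \<one> T))
      = a (F \<star> X) (Y \<otimes> Z) (F \<star> T) \<cdot> ((a X Y Z \<boxtimes> \<one> (F \<star> F \<star> T)) \<cdot> ?n)"
    by (rule paste_squares[OF r2 r3]) simp_all
  have r: "?m \<cdot> ((\<one> X \<boxtimes> b Y Z T) \<cdot> (b X (Y \<otimes> Z) T \<cdot> (b X Y Z \<boxtimes> \<one> T)))
      = (\<one> (F \<star> F \<star> X) \<boxtimes> a Y Z T) \<cdot>
        (a (F \<star> X) (Y \<otimes> Z) (F \<star> T) \<cdot> ((a X Y Z \<boxtimes> \<one> (F \<star> F \<star> T)) \<cdot> ?n))"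
    by (rule paste_squares[OF r1 r23]) simp_all
  have pent: "(a (F \<star> X) (F \<star> Y) (Z \<otimes> T) \<cdot> a (X \<otimes> Y) (F \<star> Z) (F \<star> T)) \<cdot> ?n
      = ((\<one> (F \<star> F \<star> X) \<boxtimes> a Y Z T) \<cdot> a (F \<star> X) (Y \<otimes> Z) (F \<star> T) \<cdot>
          (a X Y Z \<boxtimes> \<one> (F \<star> F \<star> T))) \<cdot> ?n"
    using hom_pentagon[of X Y Z T] by simp
  show ?thesis
    by (rule iso_arr_cancel[of ?m]) (use pent in \<open>simp_all only: l r\<close>, simp_all)
qed

lemma pre_tensor_category_b: "pre_tensor_category C b"
proof -
  \<comment> \<open>That triples form a category is part of the naturality of \<open>a\<close>.\<close>
  interpret CCC: category "C \<times>\<^sub>c C \<times>\<^sub>c C"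
    using a_natural_isomorphism
    by (simp add: natural_isomorphism_def natural_transformation_def cat_functor_def)
  show ?thesis
    by unfold_locales
      (auto simp: prod_cat_def hom_def b_pentagon intro!: b_natural)
qed

end

section \<open>Trivializing G: the quasi-braiding\<close>

locale FG_trivialized =
  F_trivialized C F G a \<Phi> \<Theta> b + hom_braided_category C F G a \<Phi> d
  for C :: "('o, 'm, 'x) tensor_cat_scheme" (structure)
    and F G :: "('o, 'm, 'o, 'm) func"
    and a :: "'o \<Rightarrow> 'o \<Rightarrow> 'o \<Rightarrow> 'm"
    and \<Phi> \<Theta> :: "'o \<Rightarrow> 'm"
    and b :: "'o \<Rightarrow> 'o \<Rightarrow> 'o \<Rightarrow> 'm"
    and d :: "'o \<Rightarrow> 'o \<Rightarrow> 'm" +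
  fixes c :: "'o \<Rightarrow> 'o \<Rightarrow> 'm"
  assumes \<Phi>_iso [simp]: "U \<in> Obj C \<Longrightarrow> iso_arr C (\<Phi> U)"
    and G_\<Theta>: "U \<in> Obj C \<Longrightarrow> G \<bullet> \<Theta> U = \<Theta> (G \<star> U)"
    and c_eq: "U \<in> Obj C \<Longrightarrow> V \<in> Obj C \<Longrightarrow> c U V = ((\<Phi> V)\<inverse> \<boxtimes> (\<Phi> U)\<inverse>) \<cdot> d U V"
begin

lemma c_typing [simp]:
  assumes "U \<in> Obj C" "V \<in> Obj C"
  shows "c U V \<in> Arr C" "Dom C (c U V) = U \<otimes> V" "Cod C (c U V) = V \<otimes> U"
  using assms by (auto simp: c_eq)

text \<open>
  Naturality of \<open>\<Phi>\<close> turns \<open>\<Phi> V' \<cdot> g\<close> into \<open>(G \<bullet> g) \<cdot> \<Phi> V\<close>, and likewise for \<open>f\<close>; then \<open>\<Phi>\<close> meets the inverse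
  in the definition of \<open>c\<close>, and naturality of \<open>d\<close> remains.
\<close>

lemma c_square:
  assumes "f \<in> hom C U U'" "g \<in> hom C V V'"
  shows "((\<Phi> V' \<cdot> g) \<boxtimes> (\<Phi> U' \<cdot> f)) \<cdot> c U V = d U' V' \<cdot> (f \<boxtimes> g)"
proof -
  have [simp]: "f \<in> Arr C" "g \<in> Arr C" "Dom C f = U" "Cod C f = U'"
    "Dom C g = V" "Cod C g = V'"
    using assms by (auto simp: hom_def)
  have [simp]: "U \<in> Obj C" "V \<in> Obj C" "U' \<in> Obj C" "V' \<in> Obj C"
    using Dom_Obj[of f] Dom_Obj[of g] Cod_Obj[of f] Cod_Obj[of g] by simp_all
  have "((\<Phi> V' \<cdot> g) \<boxtimes> (\<Phi> U' \<cdot> f)) \<cdot> c U V = (((G \<bullet> g) \<boxtimes> (G \<bullet> f)) \<cdot> (\<Phi> V \<boxtimes> \<Phi> U)) \<cdot> c U V"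
    using \<Phi>_natural[of f] \<Phi>_natural[of g] by simp
  also have "\<dots> = ((G \<bullet> g) \<boxtimes> (G \<bullet> f)) \<cdot> d U V"
    by (subst Comp_assoc_Arr) (simp_all add: c_eq)
  finally show ?thesis
    using d_natural[of f g] by simp
qed

lemma c_natural:
  assumes "f \<in> hom C U U'" "g \<in> hom C V V'"
  shows "(g \<boxtimes> f) \<cdot> c U V = c U' V' \<cdot> (f \<boxtimes> g)"
proof -
  have [simp]: "f \<in> Arr C" "g \<in> Arr C" "Dom C f = U" "Cod C f = U'"
    "Dom C g = V" "Cod C g = V'"
    using assms by (auto simp: hom_def)
  have [simp]: "U \<in> Obj C" "V \<in> Obj C" "U' \<in> Obj C" "V' \<in> Obj C"
    using Dom_Obj[of f] Dom_Obj[of g] Cod_Obj[of f] Cod_Obj[of g] by simp_all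
  show ?thesis
  proof (rule iso_arr_cancel[of "\<Phi> V' \<boxtimes> \<Phi> U'"])
    have "(\<Phi> V' \<boxtimes> \<Phi> U') \<cdot> ((g \<boxtimes> f) \<cdot> c U V) = d U' V' \<cdot> (f \<boxtimes> g)"
      using c_square[OF assms] by simp
    also have "\<dots> = (\<Phi> V' \<boxtimes> \<Phi> U') \<cdot> (c U' V' \<cdot> (f \<boxtimes> g))"
      by (simp add: c_eq)
    finally show "(\<Phi> V' \<boxtimes> \<Phi> U') \<cdot> ((g \<boxtimes> f) \<cdot> c U V) = \<dots>" .
  qed simp_all
qed

text \<open>
  The compatibility \<open>G_\<Theta>\<close> makes the two trivializations commute.  In the hexagons this joins two
  squares: pasting along \<open>b\<close> leaves \<open>\<Theta> (G \<star> U) \<cdot> \<Phi> U\<close>, whereas \<open>c_square\<close> at \<open>\<Theta> U\<close> starts from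
  \<open>\<Phi> (F \<star> U) \<cdot> \<Theta> U\<close> and thereby produces \<open>d\<close> at the object \<open>F \<star> U\<close> that \<open>H1\<close> asks for.
\<close>

lemma \<Theta>_\<Phi>: "U \<in> Obj C \<Longrightarrow> \<Theta> (G \<star> U) \<cdot> \<Phi> U = \<Phi> (F \<star> U) \<cdot> \<Theta> U"
  using \<Phi>_natural[of "\<Theta> U"] by (simp add: G_\<Theta>)

text \<open>
  Followed by \<open>?m\<close>, both sides of the hexagon are the corresponding sides of \<open>H1\<close>, preceded by
  \<open>?n\<close>.  On the right-hand side \<open>U\<close> takes part in two crossings, each of which
  applies \<open>G\<close> to it; this is why \<open>?m\<close> contains \<open>\<Phi>\<close> twice at \<open>U\<close>.
\<close>

lemma c_hexagon1:
  assumes [simp]: "U \<in> Obj C" "V \<in> Obj C" "W \<in> Obj C"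
  shows "b V W U \<cdot> c U (V \<otimes> W) \<cdot> b U V W = (\<one> V \<boxtimes> c U W) \<cdot> b V U W \<cdot> (c U V \<boxtimes> \<one> W)"
proof -
  let ?TP = "\<Theta> (G \<star> V) \<cdot> \<Phi> V"
  let ?m = "?TP \<boxtimes> (\<Phi> W \<boxtimes> (\<Phi> (G \<star> U) \<cdot> \<Phi> U))" and ?n = "\<one> (U \<otimes> V) \<boxtimes> \<Theta> W"
  let ?P = "\<one> (F \<star> G \<star> V) \<boxtimes> (\<one> (G \<star> W) \<boxtimes> \<Phi> (G \<star> U))"
  let ?m' = "?TP \<boxtimes> (\<Phi> W \<boxtimes> \<Phi> U)"
  \<comment> \<open>\<open>?m\<close> is \<open>?P\<close> after \<open>?m'\<close>: on this side the second \<open>\<Phi>\<close> at \<open>U\<close> is not moved but stays in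
    front, as the leading factor of \<open>H1\<close>.\<close>
  have l1: "?m' \<cdot> b V W U
      = a (G \<star> V) (G \<star> W) (G \<star> U) \<cdot> ((\<Phi> V \<boxtimes> \<Phi> W) \<boxtimes> (\<Theta> (G \<star> U) \<cdot> \<Phi> U))"
    using b_square[of "\<Phi> V" V "G \<star> V" "\<Phi> W" W "G \<star> W" "\<Phi> U" U "G \<star> U"]
    by (simp add: hom_def)
  have l2: "((\<Phi> V \<boxtimes> \<Phi> W) \<boxtimes> (\<Theta> (G \<star> U) \<cdot> \<Phi> U)) \<cdot> c U (V \<otimes> W)
      = d (F \<star> U) (V \<otimes> W) \<cdot> (\<Theta> U \<boxtimes> \<one> (V \<otimes> W))"
    using c_square[of "\<Theta> U" U "F \<star> U" "\<one> (V \<otimes> W)" "V \<otimes> W" "V \<otimes> W"]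
    by (simp add: hom_def \<Theta>_\<Phi>)
  have l3: "(\<Theta> U \<boxtimes> \<one> (V \<otimes> W)) \<cdot> b U V W = a U V W \<cdot> ?n"
    by (simp add: b_eq)
  have l23: "((\<Phi> V \<boxtimes> \<Phi> W) \<boxtimes> (\<Theta> (G \<star> U) \<cdot> \<Phi> U)) \<cdot> (c U (V \<otimes> W) \<cdot> b U V W)
      = d (F \<star> U) (V \<otimes> W) \<cdot> (a U V W \<cdot> ?n)"
    by (rule paste_squares[OF l2 l3]) simp_all
  have l123: "?m' \<cdot> (b V W U \<cdot> (c U (V \<otimes> W) \<cdot> b U V W))
      = a (G \<star> V) (G \<star> W) (G \<star> U) \<cdot> (d (F \<star> U) (V \<otimes> W) \<cdot> (a U V W \<cdot> ?n))"
    by (rule paste_squares[OF l1 l23]) simp_all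
  have "?m \<cdot> (b V W U \<cdot> (c U (V \<otimes> W) \<cdot> b U V W))
      = ?P \<cdot> (?m' \<cdot> (b V W U \<cdot> (c U (V \<otimes> W) \<cdot> b U V W)))"
    by simp
  then have l: "?m \<cdot> (b V W U \<cdot> (c U (V \<otimes> W) \<cdot> b U V W))
      = ?P \<cdot> (a (G \<star> V) (G \<star> W) (G \<star> U) \<cdot> (d (F \<star> U) (V \<otimes> W) \<cdot> (a U V W \<cdot> ?n)))"
    by (simp only: l123)
  have cW: "(\<Phi> W \<boxtimes> (\<Phi> (G \<star> U) \<cdot> \<Phi> U)) \<cdot> c U W = d (G \<star> U) W \<cdot> (\<Phi> U \<boxtimes> \<one> W)"
    using c_square[of "\<Phi> U" U "G \<star> U" "\<one> W" W W] by (simp add: hom_def)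
  have cV: "(\<Phi> V \<boxtimes> \<Phi> U) \<cdot> c U V = d U V"
    by (simp add: c_eq)
  have r1: "?m \<cdot> (\<one> V \<boxtimes> c U W)
      = (\<one> (F \<star> G \<star> V) \<boxtimes> d (G \<star> U) W) \<cdot> (?TP \<boxtimes> (\<Phi> U \<boxtimes> \<one> W))"
    using cW by simp
  have r2: "(?TP \<boxtimes> (\<Phi> U \<boxtimes> \<one> W)) \<cdot> b V U W
      = a (G \<star> V) (G \<star> U) W \<cdot> ((\<Phi> V \<boxtimes> \<Phi> U) \<boxtimes> \<Theta> W)"
    using b_square[of "\<Phi> V" V "G \<star> V" "\<Phi> U" U "G \<star> U" "\<one> W" W W] by (simp add: hom_def)
  have r3: "((\<Phi> V \<boxtimes> \<Phi> U) \<boxtimes> \<Theta> W) \<cdot> (c U V \<boxtimes> \<one> W) = (d U V \<boxtimes> \<one> (F \<star> W)) \<cdot> ?n"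
    using cV by simp
  have r23: "(?TP \<boxtimes> (\<Phi> U \<boxtimes> \<one> W)) \<cdot> (b V U W \<cdot> (c U V \<boxtimes> \<one> W))
      = a (G \<star> V) (G \<star> U) W \<cdot> ((d U V \<boxtimes> \<one> (F \<star> W)) \<cdot> ?n)"
    by (rule paste_squares[OF r2 r3]) simp_all
  have r: "?m \<cdot> ((\<one> V \<boxtimes> c U W) \<cdot> (b V U W \<cdot> (c U V \<boxtimes> \<one> W)))
      = (\<one> (F \<star> G \<star> V) \<boxtimes> d (G \<star> U) W) \<cdot>
        (a (G \<star> V) (G \<star> U) W \<cdot> ((d U V \<boxtimes> \<one> (F \<star> W)) \<cdot> ?n))"
    by (rule paste_squares[OF r1 r23]) simp_all
  have hex: "(?P \<cdot> a (G \<star> V) (G \<star> W) (G \<star> U) \<cdot> d (F \<star> U) (V \<otimes> W) \<cdot> a U V W) \<cdot> ?n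
      = ((\<one> (F \<star> G \<star> V) \<boxtimes> d (G \<star> U) W) \<cdot> a (G \<star> V) (G \<star> U) W \<cdot>
          (d U V \<boxtimes> \<one> (F \<star> W))) \<cdot> ?n"
    by (simp only: H1 assms)
  show ?thesis
    by (rule iso_arr_cancel[of ?m]) (use hex in \<open>simp_all only: l r\<close>, simp_all)
qed

text \<open>
  The mirror image of the first hexagon, with \<open>b_inverse_square\<close> in the role of \<open>b_square\<close>:
  now \<open>W\<close> is the object that takes part in two crossings.
\<close>

lemma c_hexagon2:
  assumes [simp]: "U \<in> Obj C" "V \<in> Obj C" "W \<in> Obj C"
  shows "(b W U V)\<inverse> \<cdot> c (U \<otimes> V) W \<cdot> (b U V W)\<inverse>
       = (c U W \<boxtimes> \<one> V) \<cdot> (b U W V)\<inverse> \<cdot> (\<one> U \<boxtimes> c V W)"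
proof -
  let ?TP = "\<Theta> (G \<star> V) \<cdot> \<Phi> V"
  let ?m = "((\<Phi> (G \<star> W) \<cdot> \<Phi> W) \<boxtimes> \<Phi> U) \<boxtimes> ?TP" and ?n = "\<Theta> U \<boxtimes> \<one> (V \<otimes> W)"
  let ?P = "(\<Phi> (G \<star> W) \<boxtimes> \<one> (G \<star> U)) \<boxtimes> \<one> (F \<star> G \<star> V)"
  let ?m' = "(\<Phi> W \<boxtimes> \<Phi> U) \<boxtimes> ?TP"
  \<comment> \<open>Again \<open>?m\<close> is \<open>?P\<close> after \<open>?m'\<close>, and \<open>?P\<close> is the leading factor of \<open>H2\<close>.\<close>
  have l1: "?m' \<cdot> (b W U V)\<inverse>
      = (a (G \<star> W) (G \<star> U) (G \<star> V))\<inverse> \<cdot> ((\<Theta> (G \<star> W) \<cdot> \<Phi> W) \<boxtimes> (\<Phi> U \<boxtimes> \<Phi> V))"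
    using b_inverse_square[of "\<Phi> W" W "G \<star> W" "\<Phi> U" U "G \<star> U" "\<Phi> V" V "G \<star> V"]
    by (simp add: hom_def)
  have l2: "((\<Theta> (G \<star> W) \<cdot> \<Phi> W) \<boxtimes> (\<Phi> U \<boxtimes> \<Phi> V)) \<cdot> c (U \<otimes> V) W
      = d (U \<otimes> V) (F \<star> W) \<cdot> (\<one> (U \<otimes> V) \<boxtimes> \<Theta> W)"
    using c_square[of "\<one> (U \<otimes> V)" "U \<otimes> V" "U \<otimes> V" "\<Theta> W" W "F \<star> W"]
    by (simp add: hom_def \<Theta>_\<Phi>)
  have l3: "(\<one> (U \<otimes> V) \<boxtimes> \<Theta> W) \<cdot> (b U V W)\<inverse> = (a U V W)\<inverse> \<cdot> ?n"
    using b_inverse_square[of "\<one> U" U U "\<one> V" V V "\<one> W" W W] by (simp add: hom_def)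
  have l23: "((\<Theta> (G \<star> W) \<cdot> \<Phi> W) \<boxtimes> (\<Phi> U \<boxtimes> \<Phi> V)) \<cdot> (c (U \<otimes> V) W \<cdot> (b U V W)\<inverse>)
      = d (U \<otimes> V) (F \<star> W) \<cdot> ((a U V W)\<inverse> \<cdot> ?n)"
    by (rule paste_squares[OF l2 l3]) simp_all
  have l123: "?m' \<cdot> ((b W U V)\<inverse> \<cdot> (c (U \<otimes> V) W \<cdot> (b U V W)\<inverse>))
      = (a (G \<star> W) (G \<star> U) (G \<star> V))\<inverse> \<cdot> (d (U \<otimes> V) (F \<star> W) \<cdot> ((a U V W)\<inverse> \<cdot> ?n))"
    by (rule paste_squares[OF l1 l23]) simp_all
  have "?m \<cdot> ((b W U V)\<inverse> \<cdot> (c (U \<otimes> V) W \<cdot> (b U V W)\<inverse>))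
      = ?P \<cdot> (?m' \<cdot> ((b W U V)\<inverse> \<cdot> (c (U \<otimes> V) W \<cdot> (b U V W)\<inverse>)))"
    by simp
  then have l: "?m \<cdot> ((b W U V)\<inverse> \<cdot> (c (U \<otimes> V) W \<cdot> (b U V W)\<inverse>))
      = ?P \<cdot> ((a (G \<star> W) (G \<star> U) (G \<star> V))\<inverse> \<cdot>
          (d (U \<otimes> V) (F \<star> W) \<cdot> ((a U V W)\<inverse> \<cdot> ?n)))"
    by (simp only: l123)
  have cU: "((\<Phi> (G \<star> W) \<cdot> \<Phi> W) \<boxtimes> \<Phi> U) \<cdot> c U W = d U (G \<star> W) \<cdot> (\<one> U \<boxtimes> \<Phi> W)"
    using c_square[of "\<one> U" U U "\<Phi> W" W "G \<star> W"] by (simp add: hom_def)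
  have cV: "(\<Phi> W \<boxtimes> \<Phi> V) \<cdot> c V W = d V W"
    by (simp add: c_eq)
  have r1: "?m \<cdot> (c U W \<boxtimes> \<one> V)
      = (d U (G \<star> W) \<boxtimes> \<one> (F \<star> G \<star> V)) \<cdot> ((\<one> U \<boxtimes> \<Phi> W) \<boxtimes> ?TP)"
    using cU by simp
  have r2: "((\<one> U \<boxtimes> \<Phi> W) \<boxtimes> ?TP) \<cdot> (b U W V)\<inverse>
      = (a U (G \<star> W) (G \<star> V))\<inverse> \<cdot> (\<Theta> U \<boxtimes> (\<Phi> W \<boxtimes> \<Phi> V))"
    using b_inverse_square[of "\<one> U" U U "\<Phi> W" W "G \<star> W" "\<Phi> V" V "G \<star> V"]
    by (simp add: hom_def)
  have r3: "(\<Theta> U \<boxtimes> (\<Phi> W \<boxtimes> \<Phi> V)) \<cdot> (\<one> U \<boxtimes> c V W) = (\<one> (F \<star> U) \<boxtimes> d V W) \<cdot> ?n"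
    using cV by simp
  have r23: "((\<one> U \<boxtimes> \<Phi> W) \<boxtimes> ?TP) \<cdot> ((b U W V)\<inverse> \<cdot> (\<one> U \<boxtimes> c V W))
      = (a U (G \<star> W) (G \<star> V))\<inverse> \<cdot> ((\<one> (F \<star> U) \<boxtimes> d V W) \<cdot> ?n)"
    by (rule paste_squares[OF r2 r3]) simp_all
  have r: "?m \<cdot> ((c U W \<boxtimes> \<one> V) \<cdot> ((b U W V)\<inverse> \<cdot> (\<one> U \<boxtimes> c V W)))
      = (d U (G \<star> W) \<boxtimes> \<one> (F \<star> G \<star> V)) \<cdot>
        ((a U (G \<star> W) (G \<star> V))\<inverse> \<cdot> ((\<one> (F \<star> U) \<boxtimes> d V W) \<cdot> ?n))"
    by (rule paste_squares[OF r1 r23]) simp_all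
  have hex: "(?P \<cdot> (a (G \<star> W) (G \<star> U) (G \<star> V))\<inverse> \<cdot> d (U \<otimes> V) (F \<star> W) \<cdot> (a U V W)\<inverse>) \<cdot> ?n
      = ((d U (G \<star> W) \<boxtimes> \<one> (F \<star> G \<star> V)) \<cdot> (a U (G \<star> W) (G \<star> V))\<inverse> \<cdot>
          (\<one> (F \<star> U) \<boxtimes> d V W)) \<cdot> ?n"
    by (simp only: H2 assms)
  show ?thesis
    by (rule iso_arr_cancel[of ?m]) (use hex in \<open>simp_all only: l r\<close>, simp_all)
qed

lemma quasi_braided_category_c: "quasi_braided_category C b c"
proof -
  interpret pre_tensor_category C b
    by (fact pre_tensor_category_b)
  show ?thesis
    by unfold_locales
      (auto simp: prod_cat_def hom_def tensor_func_def c_hexagon1 c_hexagon2 intro!: c_natural)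
qed

end

section \<open>The quasi-braided category of a trivialized hom-braided category\<close>

theorem proposition8p2:
  fixes C :: "('o, 'm, 'x) tensor_cat_scheme" (structure)
    and F G :: "('o, 'm, 'o, 'm) func"
    and a b :: "'o \<Rightarrow> 'o \<Rightarrow> 'o \<Rightarrow> 'm"
    and c d :: "'o \<Rightarrow> 'o \<Rightarrow> 'm"
    and \<Phi> \<Theta> :: "'o \<Rightarrow> 'm"
  assumes "hom_braided_category C F G a \<Phi> d"
    and "natural_isomorphism C C id_func F \<Theta>"
    and "\<And>M N. M \<in> Obj C \<Longrightarrow> N \<in> Obj C \<Longrightarrow> \<Theta> (M \<otimes> N) = \<Theta> M \<boxtimes> \<Theta> N"
    and "\<And>U V W. U \<in> Obj C \<Longrightarrow> V \<in> Obj C \<Longrightarrow> W \<in> Obj C \<Longrightarrow>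
      b U V W = ((\<Theta> U)\<inverse> \<boxtimes> \<one> (V \<otimes> W)) \<cdot> a U V W \<cdot> (\<one> (U \<otimes> V) \<boxtimes> \<Theta> W)"
    and "natural_isomorphism C C id_func G \<Phi>"
    and "\<And>U. U \<in> Obj C \<Longrightarrow> G \<bullet> \<Theta> U = \<Theta> (G \<star> U)"
    and "\<And>U V. U \<in> Obj C \<Longrightarrow> V \<in> Obj C \<Longrightarrow>
      c U V = ((\<Phi> V)\<inverse> \<boxtimes> (\<Phi> U)\<inverse>) \<cdot> d U V"
  shows "quasi_braided_category C b c"
proof -
  interpret hom_braided_category C F G a \<Phi> d
    by (rule assms(1))
  have "FG_trivialized C F G a \<Phi> \<Theta> b d c"
    by (intro FG_trivialized.intro F_trivialized.intro F_trivialized_axioms.intro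
        FG_trivialized_axioms.intro hom_tensor_category_axioms assms
        natural_isomorphism.component_iso[OF assms(5)])
  then show ?thesis
    by (rule FG_trivialized.quasi_braided_category_c)
qed

end
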